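(* Let $V=\mathbb{F}_q^n$ and let $G$ be one of $\mathrm{GL}(V)$ or $\mathrm{PGL}(V)$. Let $H$ be a subgroup of $G$ and let $K\in\mathit{Irr}(G,H)$, i.e. $K$ is an irreducible subgroup of $G$ with $H\leq K$. If $H$ is not closed in $K$, then $$\mu_{\widehat{\mathcal{I}}(K,H)}(H,K)=0.$$
   Context: $\mathbb{F}_q$ is the finite field with $q$ elements and $V=\mathbb{F}_q^n$ is the $n$-dimensional vector space over it. $G=\mathrm{GL}(V)$ acts naturally on the lattice of subspaces of $V$, and $G=\mathrm{PGL}(V)=\mathrm{GL}(V)/Z(\mathrm{GL}(V))$ acts on it by the induced action; $W^g$ denotes the image of a subspace $W$ under $g\in G$. For $H\leq G$, a subspace $W\leq V$ is $H$-invariant if $W^h=W$ for all $h\in H$; $\mathcal{S}(V,H)$ is the set of all $H$-invariant subspaces of $V$ (including $0$ and $V$). $H$ is irreducible if $\mathcal{S}(V,H)=\{0,V\}$, and reducible otherwise. $\mathit{Irr}(G,H)$ is the set of irreducible subgroups of $G$ that contain $H$. For $H\leq K\leq G$, $H$ is closed in $K$ if $H=\{g\in K : W^g=W \text{ for every } W\in\mathcal{S}(V,H)\}$; otherwise $H$ is not closed in $K$. For $K\in\mathit{Irr}(G,H)$, $\widehat{\mathcal{I}}(K,H)$ is the poset, ordered by inclusion, consisting of $H$, $K$, and all reducible subgroups of $K$ that contain $H$. For a finite poset $(P,\leq)$, the Möbius function $\mu_P:P\times P\to\mathbb{Z}$ is defined by $\mu_P(y,y)=1$, $\sum_{x\leq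 t\leq y}\mu_P(t,y)=0$ if $x<y$, and $\mu_P(x,y)=0$ unless $x\leq y$.
   Formalization: The formal theorem additionally assumes that H is reducible; without this the claim is false: if H is irreducible and H < K (e.g. n=1, q=3, H=1, K=GL_1(F_3)), then H is not closed in K, yet the poset is {H,K} and the Möbius value is -1. *)

theory Defs
  imports "HOL-Analysis.Analysis" "HOL-Algebra.Coset"
begin

section \<open>The Moebius function of a finite poset\<close>

text \<open>A finite poset is a finite set \<open>P\<close> in an ordered type. The defining recursion is solved for
  \<open>\<mu>(x, y)\<close>; the guard makes it total.
  The three lemmas below are the usual defining equations.\<close>

function moebius :: "'b::order set \<Rightarrow> 'b \<Rightarrow> 'b \<Rightarrow> int" where
  "moebius P x y =
     (if finite P \<and> x \<in> P \<and> y \<in> P \<and> x \<le> y then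
        (if x = y then 1 else - (\<Sum>t\<in>{t \<in> P. x < t \<and> t \<le> y}. moebius P t y))
      else 0)"
  by pat_completeness auto
termination
proof (relation "Wellfounded.measure (\<lambda>(P, x, y). card {t \<in> P. x < t \<and> t \<le> y})", goal_cases)
  case (2 P x y t)
  then have "{s \<in> P. t < s \<and> s \<le> y} \<subset> {s \<in> P. x < s \<and> s \<le> y}"
    by auto
  with 2 show ?case
    by (auto intro!: psubset_card_mono)
qed simp

declare moebius.simps [simp del]

lemma moebius_refl: "finite P \<Longrightarrow> y \<in> P \<Longrightarrow> moebius P y y = 1"
  by (simp add: moebius.simps)

lemma moebius_sum:
  assumes "finite P" "x \<in> P" "y \<in> P" "x < y"
  shows "(\<Sum>t\<in>{t \<in> P. x \<le> t \<and> t \<le> y}. moebius P t y) = 0"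
proof -
  have "{t \<in> P. x \<le> t \<and> t \<le> y} = insert x {t \<in> P. x < t \<and> t \<le> y}"
    using assms by (auto simp: order_le_less)
  with assms show ?thesis
    by (simp add: moebius.simps[of P x y])
qed

lemma moebius_not_le: "\<not> x \<le> y \<Longrightarrow> moebius P x y = 0"
  by (simp add: moebius.simps)


section \<open>The groups \<open>GL(V)\<close> and \<open>PGL(V)\<close> and their actions on subspaces\<close>

text \<open>Here \<open>V\<close> is \<open>'a^'n\<close> with \<open>q = CARD('a)\<close> and \<open>n = CARD('n)\<close>. Products are ordered
  so that \<open>W\<^sup>g\<close> is a right action.\<close>

definition GL :: "('a::field^'n \<Rightarrow> 'a^'n) monoid" where
  "GL = \<lparr>carrier = {g. Vector_Spaces.linear (*s) (*s) g \<and> bij g},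
         mult = (\<lambda>g h. h \<circ> g), one = id\<rparr>"

definition group_center :: "('g, 'm) monoid_scheme \<Rightarrow> 'g set" where
  "group_center G = {z \<in> carrier G. \<forall>g\<in>carrier G. z \<otimes>\<^bsub>G\<^esub> g = g \<otimes>\<^bsub>G\<^esub> z}"

definition PGL :: "('a::field^'n \<Rightarrow> 'a^'n) set monoid" where
  "PGL = GL Mod group_center GL"

text \<open>\<open>GL(V)\<close> acts on subspaces by \<open>image\<close>. All representatives of a coset \<open>C \<in> PGL(V)\<close> give
  the same image of a subspace, see \<open>PGL_act_rep\<close> below.\<close>

definition PGL_act :: "('a::field^'n \<Rightarrow> 'a^'n) set \<Rightarrow> ('a^'n) set \<Rightarrow> ('a^'n) set" where
  "PGL_act C W = the_elem ((\<lambda>g. g ` W) ` C)"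

lemma mult_GL: "g \<otimes>\<^bsub>GL\<^esub> h = h \<circ> g"
  by (simp add: GL_def)

lemma group_GL: "group (GL :: ('a::field^'n \<Rightarrow> 'a^'n) monoid)"
proof (rule groupI)
  fix g :: "'a^'n \<Rightarrow> 'a^'n"
  assume "g \<in> carrier GL"
  then have g: "Vector_Spaces.linear (*s) (*s) g" "bij g"
    by (auto simp: GL_def)
  have "Vector_Spaces.linear (*s) (*s) (inv_into UNIV g)"
    unfolding Vector_Spaces.linear_iff
  proof (intro conjI allI vec.vector_space_axioms)
    interpret g: Vector_Spaces.linear "(*s)" "(*s)" g by (rule g)
    show "inv_into UNIV g (x + y) = inv_into UNIV g x + inv_into UNIV g y" for x y
      by (rule inv_f_eq) (use g(2) in \<open>auto simp: bij_def g.add surj_f_inv_f\<close>)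
    show "inv_into UNIV g (c *s x) = c *s inv_into UNIV g x" for c x
      by (rule inv_f_eq) (use g(2) in \<open>auto simp: bij_def g.scale surj_f_inv_f\<close>)
  qed
  moreover have "bij (inv_into UNIV g)"
    using g(2) by (rule bij_imp_bij_inv)
  ultimately show "\<exists>h\<in>carrier GL. h \<otimes>\<^bsub>GL\<^esub> g = \<one>\<^bsub>GL\<^esub>"
    using g(2) by (intro bexI[of _ "inv_into UNIV g"])
       (simp_all add: GL_def fun_eq_iff bij_is_surj surj_f_inv_f)
qed (auto simp: GL_def vec.linear_id id_def[symmetric] comp_assoc
          intro: Vector_Spaces.linear_compose bij_comp)

lemma normal_group_center:
  fixes G (structure)
  assumes "group G"
  shows "group_center G \<lhd> G"
proof -
  interpret group G by fact
  have "subgroup (group_center G) G"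
  proof (rule subgroupI)
    fix a assume a: "a \<in> group_center G"
    have "inv a \<otimes> g = g \<otimes> inv a" if g: "g \<in> carrier G" for g
    proof -
      have ac: "a \<in> carrier G" and "a \<otimes> inv g = inv g \<otimes> a"
        using a g by (auto simp: group_center_def)
      then have "inv (inv g \<otimes> a) = inv (a \<otimes> inv g)" by simp
      with ac g show ?thesis by (simp add: inv_mult_group)
    qed
    with a show "inv a \<in> group_center G" by (auto simp: group_center_def)
  next
    fix a b assume ab: "a \<in> group_center G" "b \<in> group_center G"
    have "a \<otimes> b \<otimes> g = g \<otimes> (a \<otimes> b)" if g: "g \<in> carrier G" for g
    proof -
      have c: "a \<in> carrier G" "b \<in> carrier G" "a \<otimes> g = g \<otimes> a" "b \<otimes> g = g \<otimes> b"
        using ab g by (auto simp: group_center_def)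
      have "a \<otimes> b \<otimes> g = a \<otimes> (g \<otimes> b)"
        using c(1,2) g by (simp only: m_assoc c(4))
      also have "\<dots> = g \<otimes> a \<otimes> b"
        using c(1,2) g by (simp only: m_assoc[symmetric] c(3))
      also have "\<dots> = g \<otimes> (a \<otimes> b)"
        using c(1,2) g by (intro m_assoc)
      finally show ?thesis .
    qed
    moreover have "a \<otimes> b \<in> carrier G"
      using ab unfolding group_center_def by blast
    ultimately show "a \<otimes> b \<in> group_center G"
      unfolding group_center_def by blast
  next
    have "\<one> \<in> group_center G" by (simp add: group_center_def)
    then show "group_center G \<noteq> {}" by blast
  qed (auto simp: group_center_def)
  moreover have "\<forall>x\<in>carrier G. group_center G #> x = x <# group_center G"
  proof
    fix x assume "x \<in> carrier G"
    then have "z \<otimes> x = x \<otimes> z" if "z \<in> group_center G" for z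
      using that unfolding group_center_def by blast
    then have "\<And>z. z \<in> group_center G \<Longrightarrow> {z \<otimes> x} = {x \<otimes> z}"
      by (rule arg_cong)
    then show "group_center G #> x = x <# group_center G"
      unfolding r_coset_def l_coset_def by (rule SUP_cong[OF refl])
  qed
  ultimately show ?thesis
    by (rule normalI)
qed

lemma group_PGL: "group (PGL :: ('a::field^'n \<Rightarrow> 'a^'n) set monoid)"
  unfolding PGL_def by (rule normal.factorgroup_is_group[OF normal_group_center[OF group_GL]])

lemma center_GL_line:
  fixes z :: "'a::field^'n \<Rightarrow> 'a^'n"
  assumes "z \<in> group_center GL"
  shows "z v \<in> vec.span {v}"
proof (rule ccontr)
  assume *: "z v \<notin> vec.span {v}"
  have z: "Vector_Spaces.linear (*s) (*s) z" "bij z"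
    and comm: "\<And>g. g \<in> carrier GL \<Longrightarrow> g \<circ> z = z \<circ> g"
    using assms by (auto simp: group_center_def GL_def)
  interpret z: Vector_Spaces.linear "(*s)" "(*s)" z by (rule z)
  have v0: "v \<noteq> 0" using * vec.span_zero[of "{v}"] z.zero by metis
  have ne: "z v \<noteq> v" using * vec.span_base[of v "{v}"] by auto
  have "vec.independent {z v, v}"
    using * v0 ne by (simp add: vec.independent_insert)
  from vec.linear_independent_extend[OF this, of "\<lambda>x. if x = v then 0 else 1"]
  obtain f :: "'a^'n \<Rightarrow> 'a^'n" where f: "Vector_Spaces.linear (*s) (*s) f" "f v = 0" "f (z v) = 1"
    using ne by auto
  interpret f: Vector_Spaces.linear "(*s)" "(*s)" f by (rule f)
  obtain i :: 'n where True by simp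
  define g where "g = (\<lambda>x. x + (f x $ i) *s v)"
  define h where "h = (\<lambda>x. x - (f x $ i) *s v)"
  have "g \<circ> h = id" "h \<circ> g = id"
    by (auto simp: g_def h_def fun_eq_iff f.add f.diff f.scale f(2))
  then have "bij g" by (metis o_bij)
  moreover have "Vector_Spaces.linear (*s) (*s) g"
    unfolding Vector_Spaces.linear_iff
    by (auto intro!: vec.vector_space_axioms simp: g_def f.add f.scale vec_eq_iff algebra_simps)
  ultimately have "g (z v) = z (g v)"
    using comm[of g] by (auto simp: GL_def fun_eq_iff)
  then show False
    using v0 by (simp add: g_def f(2,3))
qed

lemma center_GL_image:
  fixes z :: "'a::{field,finite}^'n \<Rightarrow> 'a^'n"
  assumes "z \<in> group_center GL" "vec.subspace W"
  shows "z ` W = W"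
proof (rule card_subset_eq)
  show "z ` W \<subseteq> W"
    using center_GL_line[OF assms(1)] vec.span_minimal[OF _ assms(2)] by blast
  have "inj z" using assms by (auto simp: group_center_def GL_def bij_def)
  then show "card (z ` W) = card W" by (meson card_image inj_on_subset subset_UNIV)
qed simp

lemma PGL_act_rep:
  fixes W :: "('a::{field,finite}^'n) set"
  assumes "C \<in> carrier PGL" "g \<in> C" "vec.subspace W"
  shows "PGL_act C W = g ` W"
proof -
  obtain x :: "'a^'n \<Rightarrow> 'a^'n" where C: "C = group_center GL #>\<^bsub>GL\<^esub> x"
    using assms(1) by (auto simp: PGL_def carrier_FactGroup)
  have "h ` W = x ` W" if hC: "h \<in> C" for h
  proof -
    obtain z where "z \<in> group_center GL" "h = x \<circ> z"
      using hC unfolding C r_coset_def by (force simp: mult_GL)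
    with center_GL_image[OF _ assms(3)] show ?thesis
      by (metis image_comp)
  qed
  with assms(2) have "(\<lambda>h. h ` W) ` C = {g ` W}" by auto
  then show ?thesis by (simp add: PGL_act_def)
qed


section \<open>Invariant subspaces, irreducibility, closed subgroups\<close>

text \<open>The parameter \<open>act\<close> is the action on subspaces: \<open>act g W\<close> is \<open>W\<^sup>g\<close>.\<close>

definition invariant_subspaces ::
    "('g \<Rightarrow> ('a::field^'n) set \<Rightarrow> ('a^'n) set) \<Rightarrow> 'g set \<Rightarrow> ('a^'n) set set" where
  "invariant_subspaces act H = {W. vec.subspace W \<and> (\<forall>h\<in>H. act h W = W)}"

definition acts_irreducibly ::
    "('g \<Rightarrow> ('a::field^'n) set \<Rightarrow> ('a^'n) set) \<Rightarrow> 'g set \<Rightarrow> bool" where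
  "acts_irreducibly act H \<longleftrightarrow> invariant_subspaces act H = {{0}, UNIV}"

abbreviation acts_reducibly ::
    "('g \<Rightarrow> ('a::field^'n) set \<Rightarrow> ('a^'n) set) \<Rightarrow> 'g set \<Rightarrow> bool" where
  "acts_reducibly act H \<equiv> \<not> acts_irreducibly act H"

definition Irr ::
    "('g, 'm) monoid_scheme \<Rightarrow> ('g \<Rightarrow> ('a::field^'n) set \<Rightarrow> ('a^'n) set) \<Rightarrow> 'g set \<Rightarrow> 'g set set" where
  "Irr G act H = {K. subgroup K G \<and> acts_irreducibly act K \<and> H \<subseteq> K}"

definition closed_in ::
    "('g \<Rightarrow> ('a::field^'n) set \<Rightarrow> ('a^'n) set) \<Rightarrow> 'g set \<Rightarrow> 'g set \<Rightarrow> bool" where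
  "closed_in act H K \<longleftrightarrow> H = {g \<in> K. \<forall>W\<in>invariant_subspaces act H. act g W = W}"

definition I_hat ::
    "('g, 'm) monoid_scheme \<Rightarrow> ('g \<Rightarrow> ('a::field^'n) set \<Rightarrow> ('a^'n) set) \<Rightarrow> 'g set \<Rightarrow> 'g set \<Rightarrow> 'g set set" where
  "I_hat G act K H =
     {H, K} \<union> {X. subgroup X G \<and> H \<subseteq> X \<and> X \<subseteq> K \<and> acts_reducibly act X}"

text \<open>If \<open>H\<close> itself is irreducible and \<open>H \<noteq> K\<close>, then \<open>H\<close> is not closed in \<open>K\<close>, but the poset is the
  two-element chain \<open>H < K\<close> and the Moebius function takes the value \<open>-1\<close>. Hence vanishing
  for non-closed \<open>H\<close> can only be claimed for reducible \<open>H\<close>.\<close>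

lemma irreducible_not_closed_GL:
  fixes H :: "('a::{field,finite}^'n \<Rightarrow> 'a^'n) set"
  assumes "acts_irreducibly image H" "K \<in> Irr GL image H" "H \<noteq> K"
  shows "\<not> closed_in image H K" "moebius (I_hat GL image K H) H K = -1"
proof -
  have K: "H \<subseteq> K" "acts_irreducibly image K"
    using assms by (auto simp: Irr_def)
  have "invariant_subspaces image H = invariant_subspaces image K"
    using assms(1) K(2) by (simp add: acts_irreducibly_def)
  then have "{g \<in> K. \<forall>W\<in>invariant_subspaces image H. g ` W = W} = K"
    by (auto simp: invariant_subspaces_def)
  with assms(3) show "\<not> closed_in image H K"
    by (simp add: closed_in_def)
  have "acts_irreducibly image X" if "H \<subseteq> X" "X \<subseteq> K" for X
  proof -
    have "invariant_subspaces image K \<subseteq> invariant_subspaces image X"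
      "invariant_subspaces image X \<subseteq> invariant_subspaces image H"
      using that unfolding invariant_subspaces_def by blast+
    with assms(1) K(2) show ?thesis
      unfolding acts_irreducibly_def by (metis subset_antisym)
  qed
  then have P: "I_hat GL image K H = {H, K}"
    by (auto simp: I_hat_def)
  have "{t \<in> {H, K}. H < t \<and> t \<le> K} = {K}"
    using K(1) assms(3) by auto
  then show "moebius (I_hat GL image K H) H K = -1"
    using K(1) assms(3) unfolding P by (simp add: moebius.simps[of _ H K] moebius_refl)
qed

end

theory Submission
  imports Defs
begin

text \<open>For a subgroup \<open>X\<close> of \<open>K\<close> let \<open>cl X\<close> be the subgroup of all elements of \<open>K\<close> that fix every
  \<open>X\<close>-invariant subspace. This is the closure attached to the Galois connection between subgroups
  and sets of subspaces, so it is extensive and monotone. Moreover \<open>X\<close> and \<open>cl X\<close> have the same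
  invariant subspaces. Hence \<open>cl\<close> preserves reducibility and maps the part of the poset below \<open>K\<close>
  to itself; in particular \<open>cl X\<close> is never \<open>K\<close>, because \<open>K\<close> is irreducible.

  A poset argument in the spirit of Crapo's closure theorem does the rest. In a finite poset
  with a monotone extensive self-map of the part below \<open>y\<close>, the value \<open>\<mu>(x, y)\<close> vanishes for
  every \<open>x < y\<close> that the map moves (\<open>moebius_eq_0_if_moved\<close>). That \<open>H\<close> is not closed in \<open>K\<close> means
  exactly that \<open>cl\<close> moves \<open>H\<close>. The argument uses no more than an action of a group on subspaces,
  so \<open>GL(V)\<close> and \<open>PGL(V)\<close> are two instances of \<open>moebius_I_hat_eq_0_if_not_closed\<close>.\<close>

text \<open>Induct downwards on \<open>x\<close>. In the recursion for \<open>\<mu>(x, y)\<close> every \<open>t\<close> with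
  \<open>x < t < y\<close> that \<open>c\<close> moves contributes \<open>0\<close>, and every such \<open>t\<close> that \<open>c\<close> fixes satisfies
  \<open>t = c t \<ge> c x\<close> by monotonicity. As \<open>y \<ge> c x\<close> too, the sum over \<open>x < t \<le> y\<close> equals the sum
  over \<open>c x \<le> t \<le> y\<close>, which is \<open>0\<close> because \<open>c x < y\<close>.\<close>

lemma moebius_eq_0_if_moved:
  fixes c :: "'b::order \<Rightarrow> 'b"
  assumes fin: "finite P" and y: "y \<in> P"
    and c_in: "\<And>x. x \<in> P \<Longrightarrow> x < y \<Longrightarrow> c x \<in> P"
    and c_less: "\<And>x. x \<in> P \<Longrightarrow> x < y \<Longrightarrow> c x < y"
    and extensive: "\<And>x. x \<in> P \<Longrightarrow> x < y \<Longrightarrow> x \<le> c x"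
    and monotone: "\<And>x t. x \<in> P \<Longrightarrow> t \<in> P \<Longrightarrow> x \<le> t \<Longrightarrow> t < y \<Longrightarrow> c x \<le> c t"
    and "x \<in> P" "x < y" "c x \<noteq> x"
  shows "moebius P x y = 0"
  using assms(7-9)
proof (induction "card {t \<in> P. x < t}" arbitrary: x rule: less_induct)
  case less
  have IH: "moebius P t y = 0" if t: "t \<in> P" "x < t" "t < y" "c t \<noteq> t" for t
  proof (rule less.hyps)
    have "{s \<in> P. t < s} \<subset> {s \<in> P. x < s}"
      using t(1,2) by auto
    then show "card {s \<in> P. t < s} < card {s \<in> P. x < s}"
      using fin by (intro psubset_card_mono) auto
  qed (use t in auto)
  have x_less: "x < c x"
    using less.prems extensive by (simp add: order_less_le)
  have "(\<Sum>t\<in>{t \<in> P. x < t \<and> t \<le> y}. moebius P t y)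
      = (\<Sum>t\<in>{t \<in> P. c x \<le> t \<and> t \<le> y}. moebius P t y)"
  proof (rule sum.mono_neutral_right)
    show "\<forall>t\<in>{t \<in> P. x < t \<and> t \<le> y} - {t \<in> P. c x \<le> t \<and> t \<le> y}. moebius P t y = 0"
    proof
      fix t assume "t \<in> {t \<in> P. x < t \<and> t \<le> y} - {t \<in> P. c x \<le> t \<and> t \<le> y}"
      then have t: "t \<in> P" "x < t" "t \<le> y" "\<not> c x \<le> t"
        by auto
      have "t < y"
        using t(3,4) c_less[of x] less.prems by (auto simp: order_le_less)
      moreover from this have "c t \<noteq> t"
        using t monotone[of x t] less.prems(1) by (auto dest: less_imp_le)
      ultimately show "moebius P t y = 0"
        using t by (intro IH)
    qed
  qed (use fin x_less in auto)
  also have "\<dots> = 0"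
    using fin y less.prems c_in c_less by (intro moebius_sum)
  finally show ?case
    using less.prems by (auto simp: moebius.simps[of P x y])
qed

definition closure_in ::
    "('g \<Rightarrow> ('a::field^'n) set \<Rightarrow> ('a^'n) set) \<Rightarrow> 'g set \<Rightarrow> 'g set \<Rightarrow> 'g set" where
  "closure_in act K X = {g \<in> K. \<forall>W\<in>invariant_subspaces act X. act g W = W}"

lemma closed_in_iff_closure_in: "closed_in act H K \<longleftrightarrow> closure_in act K H = H"
  by (auto simp: closed_in_def closure_in_def)

lemma subset_closure_in: "X \<subseteq> K \<Longrightarrow> X \<subseteq> closure_in act K X"
  by (auto simp: closure_in_def invariant_subspaces_def)

lemma closure_in_mono: "X \<subseteq> Y \<Longrightarrow> closure_in act K X \<subseteq> closure_in act K Y"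
  unfolding closure_in_def invariant_subspaces_def by blast

lemma invariant_subspaces_closure_in:
  "X \<subseteq> K \<Longrightarrow> invariant_subspaces act (closure_in act K X) = invariant_subspaces act X"
  unfolding closure_in_def invariant_subspaces_def by blast

lemma subgroup_closure_in:
  fixes G (structure) and act :: "'g \<Rightarrow> ('a::field^'n) set \<Rightarrow> ('a^'n) set"
  assumes "group G" and K: "subgroup K G"
    and act_one: "\<And>W. vec.subspace W \<Longrightarrow> act \<one> W = W"
    and act_mult: "\<And>g h W. g \<in> carrier G \<Longrightarrow> h \<in> carrier G \<Longrightarrow> vec.subspace W \<Longrightarrow>
        act (g \<otimes> h) W = act h (act g W)"
  shows "subgroup (closure_in act K X) G"
proof -
  interpret group G by fact
  interpret K: subgroup K G by fact
  have subspace: "vec.subspace W" if "W \<in> invariant_subspaces act X" for W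
    using that by (simp add: invariant_subspaces_def)
  show ?thesis
  proof (rule subgroupI)
    show "closure_in act K X \<noteq> {}"
    proof -
      have "\<one> \<in> closure_in act K X"
        using act_one subspace by (simp add: closure_in_def)
      then show ?thesis by blast
    qed
  next
    fix g assume g: "g \<in> closure_in act K X"
    then have gK: "g \<in> K" and gc: "g \<in> carrier G"
      by (auto simp: closure_in_def)
    have "act (inv g) W = W" if W: "W \<in> invariant_subspaces act X" for W
    proof -
      have "act (inv g) W = act (inv g) (act g W)"
        using g W by (simp add: closure_in_def)
      also have "\<dots> = act (g \<otimes> inv g) W"
        using gc subspace[OF W] by (intro act_mult[symmetric]) auto
      finally show ?thesis
        using gc subspace[OF W] by (simp add: act_one)
    qed
    with gK show "inv g \<in> closure_in act K X"
      by (auto simp: closure_in_def)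
  qed (use subspace in \<open>auto simp: closure_in_def act_mult\<close>)
qed

text \<open>The closure is applied to all members \<open>X \<noteq> K\<close> of the poset. These are exactly the reducible
  subgroups between \<open>H\<close> and \<open>K\<close>, as \<open>H\<close> is one of them.\<close>

lemma moebius_I_hat_eq_0_if_not_closed:
  fixes G (structure) and act :: "'g \<Rightarrow> ('a::field^'n) set \<Rightarrow> ('a^'n) set"
  assumes G: "group G" and fin: "finite (carrier G)"
    and act_one: "\<And>W. vec.subspace W \<Longrightarrow> act \<one> W = W"
    and act_mult: "\<And>g h W. g \<in> carrier G \<Longrightarrow> h \<in> carrier G \<Longrightarrow> vec.subspace W \<Longrightarrow>
        act (g \<otimes> h) W = act h (act g W)"
    and H: "subgroup H G" "acts_reducibly act H"
    and K: "K \<in> Irr G act H"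
    and not_closed: "\<not> closed_in act H K"
  shows "moebius (I_hat G act K H) H K = 0"
proof -
  let ?P = "I_hat G act K H"
  have K': "subgroup K G" "acts_irreducibly act K" "H \<subseteq> K"
    using K by (auto simp: Irr_def)
  have below_K: "subgroup X G \<and> H \<subseteq> X \<and> X \<subseteq> K \<and> acts_reducibly act X"
    if "X \<in> ?P" "X < K" for X
    using that H K'(3) by (auto simp: I_hat_def)
  have closure_reducible: "acts_reducibly act (closure_in act K X)" if "X \<in> ?P" "X < K" for X
    using below_K[OF that] by (simp add: acts_irreducibly_def invariant_subspaces_closure_in)
  show ?thesis
  proof (rule moebius_eq_0_if_moved[where c = "closure_in act K"])
    have "?P \<subseteq> Pow (carrier G)"
      using H(1) K'(1) by (auto simp: I_hat_def dest: subgroup.subset)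
    then show "finite ?P"
      using fin by (meson finite_Pow_iff finite_subset)
  next
    fix X assume X: "X \<in> ?P" "X < K"
    show extensive: "X \<subseteq> closure_in act K X"
      using below_K[OF X] by (simp add: subset_closure_in)
    have "closure_in act K X \<subseteq> K"
      by (auto simp: closure_in_def)
    moreover have "subgroup (closure_in act K X) G"
      using G K'(1) act_one act_mult by (rule subgroup_closure_in)
    ultimately show "closure_in act K X \<in> ?P"
      using closure_reducible[OF X] below_K[OF X] extensive unfolding I_hat_def by blast
    show "closure_in act K X < K"
      using closure_reducible[OF X] K'(2) \<open>closure_in act K X \<subseteq> K\<close> by auto
  next
    show "H < K"
      using H(2) K'(2,3) by auto
  qed (use not_closed in \<open>auto simp: I_hat_def closed_in_iff_closure_in closure_in_mono\<close>)
qed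

lemma subspace_image_GL:
  fixes g :: "'a::field^'n \<Rightarrow> 'a^'n"
  assumes "g \<in> carrier GL" "vec.subspace W"
  shows "vec.subspace (g ` W)"
  using assms by (auto simp: GL_def intro: vec.linear_subspace_image)

lemma one_GL: "\<one>\<^bsub>GL\<^esub> = id"
  by (simp add: GL_def)

lemma PGL_act_one:
  fixes W :: "('a::{field,finite}^'n) set"
  assumes "vec.subspace W"
  shows "PGL_act \<one>\<^bsub>PGL\<^esub> W = W"
proof -
  interpret PGL: group "PGL :: ('a^'n \<Rightarrow> 'a^'n) set monoid" by (rule group_PGL)
  interpret N: normal "group_center GL" "GL :: ('a^'n \<Rightarrow> 'a^'n) monoid"
    by (rule normal_group_center[OF group_GL])
  have "id \<in> (\<one>\<^bsub>PGL\<^esub> :: ('a^'n \<Rightarrow> 'a^'n) set)"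
    using subgroup.one_closed[OF N.subgroup_axioms] by (simp add: PGL_def FactGroup_def one_GL)
  from PGL_act_rep[OF PGL.one_closed this assms] show ?thesis
    by simp
qed

lemma PGL_act_mult:
  fixes W :: "('a::{field,finite}^'n) set"
  assumes C: "C \<in> carrier PGL" and D: "D \<in> carrier PGL" and W: "vec.subspace W"
  shows "PGL_act (C \<otimes>\<^bsub>PGL\<^esub> D) W = PGL_act D (PGL_act C W)"
proof -
  interpret PGL: group "PGL :: ('a^'n \<Rightarrow> 'a^'n) set monoid" by (rule group_PGL)
  interpret N: normal "group_center GL" "GL :: ('a^'n \<Rightarrow> 'a^'n) monoid"
    by (rule normal_group_center[OF group_GL])
  have rep: "\<exists>g. g \<in> B \<and> g \<in> carrier GL" if "B \<in> carrier PGL" for B :: "('a^'n \<Rightarrow> 'a^'n) set"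
    using that N.rcos_self N.subgroup_axioms by (auto simp: PGL_def carrier_FactGroup)
  obtain g h where g: "g \<in> C" "g \<in> carrier GL" and h: "h \<in> D"
    using rep[OF C] rep[OF D] by blast
  have "h \<circ> g \<in> C \<otimes>\<^bsub>PGL\<^esub> D"
    using g h by (auto simp: PGL_def FactGroup_def set_mult_def mult_GL)
  then have "PGL_act (C \<otimes>\<^bsub>PGL\<^esub> D) W = h ` g ` W"
    using PGL_act_rep[OF PGL.m_closed[OF C D] _ W] by (metis image_comp)
  also have "\<dots> = PGL_act D (PGL_act C W)"
    using PGL_act_rep[OF C g(1) W] PGL_act_rep[OF D h subspace_image_GL[OF g(2) W]] by simp
  finally show ?thesis .
qed

theorem proposition1p1:
  shows
    "(\<forall>H K. subgroup H (GL :: ('a::{field,finite}^'n \<Rightarrow> 'a^'n) monoid)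
        \<and> acts_reducibly image H
        \<and> K \<in> Irr GL image H
        \<and> \<not> closed_in image H K
        \<longrightarrow> moebius (I_hat GL image K H) H K = 0)
   \<and> (\<forall>H K. subgroup H (PGL :: ('a^'n \<Rightarrow> 'a^'n) set monoid)
        \<and> acts_reducibly PGL_act H
        \<and> K \<in> Irr PGL PGL_act H
        \<and> \<not> closed_in PGL_act H K
        \<longrightarrow> moebius (I_hat PGL PGL_act K H) H K = 0)"
proof (intro conjI allI impI; elim conjE)
  fix H K :: "('a^'n \<Rightarrow> 'a^'n) set"
  assume "subgroup H GL" "acts_reducibly image H" "K \<in> Irr GL image H" "\<not> closed_in image H K"
  then show "moebius (I_hat GL image K H) H K = 0"
    by (intro moebius_I_hat_eq_0_if_not_closed group_GL) (auto simp: GL_def image_comp)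
next
  fix H K :: "('a^'n \<Rightarrow> 'a^'n) set set"
  assume "subgroup H PGL" "acts_reducibly PGL_act H" "K \<in> Irr PGL PGL_act H"
    "\<not> closed_in PGL_act H K"
  then show "moebius (I_hat PGL PGL_act K H) H K = 0"
    by (intro moebius_I_hat_eq_0_if_not_closed group_PGL PGL_act_one PGL_act_mult) simp_all
qed

end
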